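(* There is an absolute constant $C$ such that the following holds for every integer $n \ge 1$. If $X \subset \{1, \dots, n-1\}$ is symmetric and coprime-cube-free, then $$|X| \le \tfrac{5}{6} n + C .$$ In fact the same bound holds for every symmetric $X \subset \{1,\dots,n-1\}$ provided only that there are no integer $x$ and $h \in \{1,-1\}$ with $$\mathrm{cube}(x, x, x+h) = \{x,\ x+h,\ 2x,\ 2x+h,\ 3x+h\} \subset X .$$
   Context: For integers $x,y,z$, define $\mathrm{cube}(x,y,z) = \{x, y, z, x+y, x+z, y+z, x+y+z\}$ (sums taken in $\mathbf{Z}$). A subset $X \subset \{1,\dots,n-1\}$ is symmetric if $k \in X \iff n-k \in X$. It is coprime-cube-free if there do not exist integers $x,y,z$ (not necessarily distinct) with $\gcd(x,y,z,n) = 1$ and $\mathrm{cube}(x,y,z) \subset X$. *)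

theory Defs
  imports Complex_Main
begin

definition cube :: "int \<Rightarrow> int \<Rightarrow> int \<Rightarrow> int set" where
  "cube x y z = {x, y, z, x + y, x + z, y + z, x + y + z}"

text \<open>For \<open>X \<subseteq> {1..n - 1}\<close> it is immaterial that \<open>k\<close> ranges over all integers
  rather than only over \<open>{1..n - 1}\<close>.\<close>

definition symmetric_set :: "int \<Rightarrow> int set \<Rightarrow> bool" where
  "symmetric_set n X \<longleftrightarrow> (\<forall>k. k \<in> X \<longleftrightarrow> n - k \<in> X)"

definition coprime_cube_free :: "int \<Rightarrow> int set \<Rightarrow> bool" where
  "coprime_cube_free n X \<longleftrightarrow> \<not> (\<exists>x y z. Gcd {x, y, z, n} = 1 \<and> cube x y z \<subseteq> X)"

lemma cube_diagonal: "cube x x (x + h) = {x, x + h, 2 * x, 2 * x + h, 3 * x + h}"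
  by (auto simp: cube_def)

end

(* Let Y be the complement of X in {1..n - 1}. Every pattern cube x x (x + h) that fits into
   {1..n - 1} meets Y, which gives about 2n/3 incidences for 1 <= x < n/3 and h = 1, -1. An element y
   lies in at most 4 patterns as x or x + h if y < n/3, in at most 2 as 2x or 2x + h if
   y < 2n/3, and in at most 1 as 3x + h. So y and n - y together account for at most
   8 incidences, whichever third they lie in, and the symmetry of Y gives 2n/3 <= 4|Y| up to a
   constant. *)

theory Submission
  imports Defs
begin

text \<open>Families of incidences at pairwise distinct positions share the single budget
  \<open>sum f R\<close>. Taking \<open>T\<close> empty bounds one family alone.\<close>

lemma sum_images_le:
  fixes f :: "'a \<Rightarrow> int"
  assumes "finite R" "\<And>r. f r \<ge> 0" "inj_on g S" "inj_on h T"
    and "g ` S \<subseteq> R" "h ` T \<subseteq> R" "g ` S \<inter> h ` T = {}"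
  shows "(\<Sum>x\<in>S. f (g x)) + (\<Sum>x\<in>T. f (h x)) \<le> sum f R"
proof -
  have fin: "finite (g ` S)" "finite (h ` T)"
    using assms(1,5,6) by (auto intro: finite_subset)
  have "(\<Sum>x\<in>S. f (g x)) + (\<Sum>x\<in>T. f (h x)) = sum f (g ` S) + sum f (h ` T)"
    using assms by (simp add: sum.reindex)
  also have "\<dots> = sum f (g ` S \<union> h ` T)"
    using fin assms by (simp add: sum.union_disjoint)
  also have "\<dots> \<le> sum f R"
    using assms by (intro sum_mono2) auto
  finally show ?thesis .
qed

text \<open>Weighted form of the count: \<open>f\<close> stands for the indicator of the complement,
  so multiplicities of incidences become coefficients of sums.\<close>

lemma sum_hitting_symmetric:
  fixes f :: "int \<Rightarrow> int" and n :: int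
  assumes n: "n \<ge> 1"
    and nonneg: "\<And>k. f k \<ge> 0"
    and sym: "\<And>k. f (n - k) = f k"
    and hit: "\<And>x h. h \<in> {1, -1} \<Longrightarrow> cube x x (x + h) \<subseteq> {1..n - 1} \<Longrightarrow>
      1 \<le> f x + f (x + h) + f (2 * x) + f (2 * x + h) + f (3 * x + h)"
  shows "n - 8 \<le> 6 * sum f {1..n - 1}"
proof -
  \<comment> \<open>For \<open>x \<le> m\<close> this keeps \<open>3 * x + 1\<close> below
    \<open>n\<close>, and it keeps the reflection of \<open>{1..m + 1}\<close> above
    \<open>2 * m + 1\<close>.\<close>
  define m where "m = n div 3 - 1"
  have m: "3 * m + 3 \<le> n" "n \<le> 3 * m + 5" "m \<ge> -1" using n unfolding m_def by auto
  define A where "A = sum f {1..m + 1}"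
  define B where "B = sum f {1..2 * m + 1}"
  define T where "T = sum f {1..n - 1}"
  \<comment> \<open>Each \<open>x\<close> carries one pattern for each sign of \<open>h\<close>;
    starting at 2 keeps \<open>x - 1\<close> positive.\<close>
  have "2 * (m - 1) \<le> (\<Sum>x\<in>{2..m}. 2 :: int)" by simp
  also have "\<dots> \<le> (\<Sum>x\<in>{2..m}. (f x + f (x + 1) + f (2 * x) + f (2 * x + 1) + f (3 * x + 1))
                      + (f x + f (x - 1) + f (2 * x) + f (2 * x - 1) + f (3 * x - 1)))"
  proof (rule sum_mono)
    fix x assume "x \<in> {2..m}"
    then have "cube x x (x + 1) \<subseteq> {1..n - 1}" "cube x x (x + (-1)) \<subseteq> {1..n - 1}"
      using m by (auto simp: cube_def)
    from hit[OF _ this(1)] hit[OF _ this(2)]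
    show "2 \<le> (f x + f (x + 1) + f (2 * x) + f (2 * x + 1) + f (3 * x + 1))
               + (f x + f (x - 1) + f (2 * x) + f (2 * x - 1) + f (3 * x - 1))"
      by simp
  qed
  also have "\<dots> = 2 * (\<Sum>x\<in>{2..m}. f x) + (\<Sum>x\<in>{2..m}. f (x + 1)) + (\<Sum>x\<in>{2..m}. f (x - 1))
      + ((\<Sum>x\<in>{2..m}. f (2 * x)) + (\<Sum>x\<in>{2..m}. f (2 * x + 1)))
      + ((\<Sum>x\<in>{2..m}. f (2 * x)) + (\<Sum>x\<in>{2..m}. f (2 * x - 1)))
      + ((\<Sum>x\<in>{2..m}. f (3 * x + 1)) + (\<Sum>x\<in>{2..m}. f (3 * x - 1)))"
    by (simp add: sum.distrib sum_distrib_left)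
  also have "\<dots> \<le> 2 * A + A + A + B + B + T"
  proof -
    have shift: "(\<Sum>x\<in>{2..m}. f (x + d)) \<le> A" if "d \<in> {-1, 0, 1}" for d
      using sum_images_le[of "{1..m + 1}" f "\<lambda>x. x + d" "{2..m}" id "{}"] that nonneg
      by (auto simp: A_def)
    \<comment> \<open>Parity separates the two families here; residues mod 3 do so in
      \<open>triple\<close>.\<close>
    have double: "(\<Sum>x\<in>{2..m}. f (2 * x)) + (\<Sum>x\<in>{2..m}. f (2 * x + d)) \<le> B"
      if "d \<in> {-1, 1}" for d
      unfolding B_def
    proof (intro sum_images_le nonneg)
      show "(\<lambda>x. 2 * x) ` {2..m} \<inter> (\<lambda>x. 2 * x + d) ` {2..m} = {}"
        using that by (auto, presburger+)
    qed (use that in \<open>auto simp: inj_on_def\<close>)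
    have triple: "(\<Sum>x\<in>{2..m}. f (3 * x + 1)) + (\<Sum>x\<in>{2..m}. f (3 * x - 1)) \<le> T"
      unfolding T_def
    proof (intro sum_images_le nonneg)
      show "(\<lambda>x. 3 * x + 1) ` {2..m} \<inter> (\<lambda>x. 3 * x - 1) ` {2..m} = {}"
        by (auto, presburger)
    qed (use m in \<open>auto simp: inj_on_def\<close>)
    show ?thesis
      using shift[of 0] shift[of 1] shift[of "-1"] double[of 1] double[of "-1"] triple by simp
  qed
  finally have count: "2 * (m - 1) \<le> 4 * A + 2 * B + T" by simp
  \<comment> \<open>By symmetry \<open>A\<close> is also the weight of
    \<open>{n - m - 1..n - 1}\<close>, which starts beyond \<open>2 * m + 1\<close> because
    \<open>3 * m + 3 \<le> n\<close>.\<close>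
  have reflect: "A + sum f {1..k} \<le> T" if "k \<le> 2 * m + 1" "k \<le> n - 1" for k
  proof -
    have "(\<Sum>x\<in>{1..m + 1}. f (n - x)) + (\<Sum>x\<in>{1..k}. f x) \<le> T"
      unfolding T_def using m nonneg that by (intro sum_images_le) (auto simp: inj_on_def)
    then show ?thesis by (simp add: sym A_def)
  qed
  have "A + A \<le> T"
  \<comment> \<open>For \<open>m = -1\<close> the choice \<open>k = m + 1\<close> exceeds
    \<open>2 * m + 1\<close>, but then \<open>A\<close> is an empty sum.\<close>
  proof (cases "m \<ge> 0")
    case True
    with reflect[of "m + 1"] m show ?thesis by (simp add: A_def)
  next
    case False
    with nonneg show ?thesis by (simp add: A_def T_def sum_nonneg)
  qed
  moreover have "A + B \<le> T" using reflect[of "2 * m + 1"] m n by (simp add: B_def)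
  \<comment> \<open>Here \<open>4 * A + 2 * B + T = 2 * (A + B) + (A + A) + T \<le> 4 * T\<close>,
    so \<open>3 * (m - 1) \<le> 6 * T\<close>, and \<open>n - 8 \<le> 3 * (m - 1)\<close>.\<close>
  ultimately show ?thesis using count m by (simp add: T_def)
qed

lemma card_symmetric_no_diagonal_cube:
  fixes n :: int
  assumes n: "n \<ge> 1" and X: "X \<subseteq> {1..n - 1}" and sym: "symmetric_set n X"
    and free: "\<not> (\<exists>x. \<exists>h \<in> {1, -1}. cube x x (x + h) \<subseteq> X)"
  shows "real (card X) \<le> 5 / 6 * real_of_int n + 1"
proof -
  define Y where "Y = {1..n - 1} - X"
  define f :: "int \<Rightarrow> int" where "f k = of_bool (k \<in> Y)" for k
  have "n - 8 \<le> 6 * sum f {1..n - 1}"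
  proof (rule sum_hitting_symmetric[OF n])
    show "f k \<ge> 0" for k by (simp add: f_def)
    have "n - k \<in> X \<longleftrightarrow> k \<in> X" for k using sym by (simp add: symmetric_set_def)
    then show "f (n - k) = f k" for k by (auto simp: f_def Y_def)
    fix x h :: int
    assume h: "h \<in> {1, -1}" and sub: "cube x x (x + h) \<subseteq> {1..n - 1}"
    then have "cube x x (x + h) \<inter> Y \<noteq> {}" using free unfolding Y_def by blast
    then show "1 \<le> f x + f (x + h) + f (2 * x) + f (2 * x + h) + f (3 * x + h)"
      unfolding cube_diagonal f_def by auto
  qed
  also have "sum f {1..n - 1} = int (card Y)"
  proof -
    have "{1..n - 1} \<inter> Y = Y" by (auto simp: Y_def)
    then show ?thesis by (simp add: f_def sum.If_cases of_bool_def)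
  qed
  finally have "n - 8 \<le> 6 * int (card Y)" .
  moreover have "int (card Y) = n - 1 - int (card X)"
  proof -
    have "card X \<le> card {1..n - 1}" using X by (intro card_mono) auto
    moreover have "card Y = card {1..n - 1} - card X"
      unfolding Y_def using X finite_subset by (intro card_Diff_subset) auto
    ultimately show ?thesis using n by auto
  qed
  \<comment> \<open>The two facts give \<open>6 * card X \<le> 5 * n + 2\<close>, an excess of 1/3
    that is rounded up to 1.\<close>
  ultimately show ?thesis by linarith
qed

theorem proposition5p7:
  "\<exists>C :: real. \<forall>n :: int. n \<ge> 1 \<longrightarrow>
     (\<forall>X. X \<subseteq> {1..n - 1} \<and> symmetric_set n X \<and> coprime_cube_free n X
        \<longrightarrow> real (card X) \<le> 5 / 6 * real_of_int n + C) \<and>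
     (\<forall>X. X \<subseteq> {1..n - 1} \<and> symmetric_set n X \<and>
        \<not> (\<exists>x. \<exists>h \<in> {1, -1}. cube x x (x + h) \<subseteq> X)
        \<longrightarrow> real (card X) \<le> 5 / 6 * real_of_int n + C)"
proof -
  \<comment> \<open>The gcd divides the difference \<open>h\<close> of two entries, a unit, so every
    diagonal pattern is a coprime cube.\<close>
  have "Gcd {x, x, x + h, n} = 1" if "h \<in> {1, -1}" for x h n :: int
  proof -
    have "Gcd {x, x, x + h, n} dvd x + h - x"
      by (intro dvd_diff Gcd_dvd) auto
    with that have "is_unit (Gcd {x, x, x + h, n})" by auto
    then show ?thesis using Gcd_int_greater_eq_0[of "{x, x, x + h, n}"] by (simp only: zdvd1_eq)
  qed
  then have no_diag: "\<not> (\<exists>x. \<exists>h \<in> {1, -1}. cube x x (x + h) \<subseteq> X)"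
    if "coprime_cube_free n X" for n X
    using that unfolding coprime_cube_free_def by blast
  show ?thesis
    by (intro exI[of _ 1] allI impI conjI; elim conjE; rule card_symmetric_no_diagonal_cube)
      (assumption | erule no_diag)+
qed

end
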